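(* Let $n\geq 2$ and $v\geq 2$ be integers. Then the graph $\Gamma(n,v)$ defined below is strongly $(n,v)$-clique-partitioned, and it has exactly $\frac{n}{2}v(v-1)+\frac{nv(n-1)(v-2)}{2}$ edges; hence the upper bound $\frac{n}{2}v(v-1)+\frac{nv(n-1)(v-2)}{2}$ on the number of edges of a strongly $(n,v)$-clique-partitioned graph is attained.
   Context: The graph $\Gamma(n,v)$ has vertex set $\{(i,j):0\leq i\leq n-1,\ 0\leq j\leq v-1\}$, and $(i,j)$ is adjacent to $(k,\ell)$ if and only if one of the following holds: (1) $i=k$ and $j\neq \ell$; (2) $i<k$ and $\ell-j\not\equiv 0$ and $\ell-j\not\equiv 1 \pmod v$; (3) $i>k$ and $j-\ell\not\equiv 0$ and $j-\ell\not\equiv 1\pmod v$. A $v$-clique is a set of $v$ pairwise adjacent vertices. A graph of order $nv$ is weakly $(n,v)$-clique-partitioned if its vertex set can be decomposed in a unique way into $n$ vertex-disjoint $v$-cliques; it is strongly $(n,v)$-clique-partitioned if moreover the only $v$-cliques in it are the $n$ cliques of that decomposition. *)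

theory Defs
  imports Complex_Main "HOL-Library.Ramsey" "HOL-Library.Disjoint_Sets" "HOL-Number_Theory.Cong"
begin

(* A finite simple graph is given by a vertex set V and a set E of two-element subsets
   of V; this is the encoding of edges that clique (from HOL-Library.Ramsey) uses. *)

definition simple_graph :: "'a set \<Rightarrow> 'a set set \<Rightarrow> bool" where
  "simple_graph V E \<longleftrightarrow> finite V \<and> E \<subseteq> [V]\<^bsup>2\<^esup>"

definition v_cliques :: "'a set \<Rightarrow> 'a set set \<Rightarrow> nat \<Rightarrow> 'a set set" where
  "v_cliques V E v = {K \<in> [V]\<^bsup>v\<^esup>. clique K E}"

definition clique_decomposition ::
    "'a set \<Rightarrow> 'a set set \<Rightarrow> nat \<Rightarrow> nat \<Rightarrow> 'a set set \<Rightarrow> bool" where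
  "clique_decomposition V E n v P \<longleftrightarrow>
     partition_on V P \<and> card P = n \<and> P \<subseteq> v_cliques V E v"

definition weakly_clique_partitioned ::
    "nat \<Rightarrow> nat \<Rightarrow> 'a set \<Rightarrow> 'a set set \<Rightarrow> bool" where
  "weakly_clique_partitioned n v V E \<longleftrightarrow>
     simple_graph V E \<and> card V = n * v \<and> (\<exists>!P. clique_decomposition V E n v P)"

definition strongly_clique_partitioned ::
    "nat \<Rightarrow> nat \<Rightarrow> 'a set \<Rightarrow> 'a set set \<Rightarrow> bool" where
  "strongly_clique_partitioned n v V E \<longleftrightarrow>
     weakly_clique_partitioned n v V E \<and>
     (\<forall>P. clique_decomposition V E n v P \<longrightarrow> v_cliques V E v = P)"

definition Gamma_verts :: "nat \<Rightarrow> nat \<Rightarrow> (nat \<times> nat) set" where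
  "Gamma_verts n v = {(i, j). i < n \<and> j < v}"

(* Column differences are taken in the integers, since subtraction on nat truncates. *)
fun Gamma_adj :: "nat \<Rightarrow> nat \<times> nat \<Rightarrow> nat \<times> nat \<Rightarrow> bool" where
  "Gamma_adj v (i, j) (k, l) \<longleftrightarrow>
     i = k \<and> j \<noteq> l
   \<or> i < k \<and> \<not> [int l - int j = 0] (mod int v) \<and> \<not> [int l - int j = 1] (mod int v)
   \<or> i > k \<and> \<not> [int j - int l = 0] (mod int v) \<and> \<not> [int j - int l = 1] (mod int v)"

definition Gamma_edges :: "nat \<Rightarrow> nat \<Rightarrow> (nat \<times> nat) set set" where
  "Gamma_edges n v =
     {{x, y} | x y. x \<in> Gamma_verts n v \<and> y \<in> Gamma_verts n v \<and> Gamma_adj v x y}"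

lemma Gamma_adj_sym: "Gamma_adj v x y \<longleftrightarrow> Gamma_adj v y x"
  by (cases x; cases y) auto

lemma Gamma_edges_iff:
  "{x, y} \<in> Gamma_edges n v \<longleftrightarrow>
     x \<in> Gamma_verts n v \<and> y \<in> Gamma_verts n v \<and> Gamma_adj v x y"
  unfolding Gamma_edges_def mem_Collect_eq doubleton_eq_iff using Gamma_adj_sym by blast

end

theory Submission
  imports Defs
begin

text \<open>
  Both halves rest on counting degrees. In a strongly clique-partitioned graph, a vertex x outside
  a part L misses at least two vertices of L: otherwise exchanging x for a suitable vertex of L
  would give a further v-clique. Hence every degree is at most (v - 1) + (n - 1)(v - 2), and in
  the graph \<open>\<Gamma>(n,v)\<close> every degree equals this number.

  In a v-clique of \<open>\<Gamma>(n,v)\<close> the columns are pairwise different, so each column occurs exactly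
  once; passing to the cyclically next column never increases the row index, so the row index is
  constant.
\<close>

section \<open>The degree sum of a finite simple graph\<close>

text \<open>Double counting of the pairs of a vertex and an edge through it: sending
  \<open>y\<close> to \<open>{x, y}\<close> turns neighbours of \<open>x\<close> into edges through
  \<open>x\<close>, and each edge has two ends.\<close>

lemma handshake:
  assumes "simple_graph V E"
  shows "(\<Sum>x\<in>V. card {y\<in>V. {x, y} \<in> E}) = 2 * card E"
proof -
  have finV: "finite V" and E: "\<And>e. e \<in> E \<Longrightarrow> e \<subseteq> V \<and> card e = 2"
    using assms by (auto simp: simple_graph_def nsets_def)
  have finE: "finite E"
    using finV E by (intro finite_subset[of E "Pow V"]) auto
  have deg: "card {y\<in>V. {x, y} \<in> E} = card {e\<in>E. x \<in> e}" for x
  proof (rule bij_betw_same_card[of "\<lambda>y. {x, y}"], rule bij_betw_imageI)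
    show "inj_on (\<lambda>y. {x, y}) {y\<in>V. {x, y} \<in> E}"
      by (auto simp: inj_on_def doubleton_eq_iff)
    show "(\<lambda>y. {x, y}) ` {y\<in>V. {x, y} \<in> E} = {e\<in>E. x \<in> e}"
    proof (intro equalityI subsetI)
      fix e assume e: "e \<in> {e\<in>E. x \<in> e}"
      with E obtain a b where "e = {a, b}" "a \<noteq> b" by (metis card_2_iff mem_Collect_eq)
      with e obtain y where "e = {x, y}" by blast
      with e E show "e \<in> (\<lambda>y. {x, y}) ` {y\<in>V. {x, y} \<in> E}" by fastforce
    qed auto
  qed
  have "(\<Sum>x\<in>V. card {y\<in>V. {x, y} \<in> E}) = (\<Sum>x\<in>V. card {e\<in>E. x \<in> e})"
    by (simp add: deg)
  also have "\<dots> = (\<Sum>e\<in>E. card {x\<in>V. x \<in> e})"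
    by (rule sum_multicount_gen[symmetric]) (use finV finE in auto)
  also have "\<dots> = (\<Sum>e\<in>E. 2)"
  proof (rule sum.cong[OF refl])
    fix e assume "e \<in> E"
    then have "{x\<in>V. x \<in> e} = e" and "card e = 2" using E by blast+
    then show "card {x\<in>V. x \<in> e} = 2" by simp
  qed
  finally show ?thesis by simp
qed

section \<open>Adjacency and degrees in \<Gamma>(n,v)\<close>

lemma Gamma_verts_Times: "Gamma_verts n v = {..<n} \<times> {..<v}"
  by (auto simp: Gamma_verts_def)

lemma diff_cong_0_iff:
  assumes "l < v" and "j < v"
  shows "[int l - int j = 0] (mod int v) \<longleftrightarrow> l = j"
  using cong_less_imp_eq_nat[of l v j] assms by (auto simp: cong_diff_iff_cong_0 cong_int_iff)

lemma diff_cong_1_iff: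
  assumes "l < v"
  shows "[int l - int j = 1] (mod int v) \<longleftrightarrow> l = Suc j mod v"
proof -
  have "[int l - int j = 1] (mod int v) \<longleftrightarrow> [int l = int (Suc j)] (mod int v)"
    by (simp add: cong_iff_dvd_diff algebra_simps)
  also have "\<dots> \<longleftrightarrow> l = Suc j mod v"
    using assms by (simp only: cong_int_iff) (simp add: cong_def)
  finally show ?thesis .
qed

text \<open>Columns below \<open>v\<close> are congruent only if equal, so all three cases of
  adjacency demand different columns. Between different rows, the vertex with the larger row index
  must moreover avoid the cyclic successor of the other vertex's column.\<close>

lemma Gamma_adj_iff:
  assumes "j < v" and "l < v"
  shows "Gamma_adj v (i, j) (k, l) \<longleftrightarrow>
    j \<noteq> l \<and> (i < k \<longrightarrow> l \<noteq> Suc j mod v) \<and> (k < i \<longrightarrow> j \<noteq> Suc l mod v)"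
  using assms by (auto simp: diff_cong_0_iff diff_cong_1_iff)

text \<open>The own row loses only column \<open>j\<close>; a row of larger index also loses the
  cyclic successor of \<open>j\<close>, and a row of smaller index its cyclic predecessor. Since
  \<open>v \<ge> 2\<close>, both differ from \<open>j\<close>.\<close>

lemma card_Gamma_neighbours_column:
  assumes "j < v" and "v \<ge> 2"
  shows "card {l. l < v \<and> Gamma_adj v (i, j) (k, l)} = (if k = i then v - 1 else v - 2)"
proof -
  \<comment> \<open>The cyclic predecessor of \<open>j\<close>, which solves
    \<open>j = Suc l mod v\<close> for \<open>l\<close>.\<close>
  let ?p = "if j = 0 then v - 1 else j - 1"
  have pred: "j = Suc l mod v \<longleftrightarrow> l = ?p" if "l < v" for l
    using that assms by (cases "Suc l = v") auto
  have next_column: "Suc j mod v < v" "Suc j mod v \<noteq> j"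
    using assms by (cases "Suc j = v"; simp)+
  have "{l. l < v \<and> Gamma_adj v (i, j) (k, l)} =
      {..<v} - (if k = i then {j} else if i < k then {j, Suc j mod v} else {j, ?p})"
    using assms pred by (auto simp: Gamma_adj_iff simp del: Gamma_adj.simps split del: if_split)
      (auto split: if_splits)
  moreover have "card ({..<v} - {j}) = v - 1"
    using assms by (subst card_Diff_subset) auto
  moreover have "card ({..<v} - {j, Suc j mod v}) = v - 2"
    using assms next_column by (subst card_Diff_subset) auto
  moreover have "card ({..<v} - {j, ?p}) = v - 2"
    using assms by (subst card_Diff_subset) auto
  ultimately show ?thesis by simp
qed

lemma Gamma_degree:
  assumes "x \<in> Gamma_verts n v" and "v \<ge> 2"
  shows "card {y\<in>Gamma_verts n v. {x, y} \<in> Gamma_edges n v} = (v - 1) + (n - 1) * (v - 2)"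
proof -
  obtain i j where x: "x = (i, j)" and i: "i < n" and j: "j < v"
    using assms by (auto simp: Gamma_verts_def)
  have "{y\<in>Gamma_verts n v. {x, y} \<in> Gamma_edges n v} =
      Sigma {..<n} (\<lambda>k. {l. l < v \<and> Gamma_adj v (i, j) (k, l)})"
    using i j by (auto simp: x Gamma_edges_iff Gamma_verts_Times simp del: Gamma_adj.simps)
  then have "card {y\<in>Gamma_verts n v. {x, y} \<in> Gamma_edges n v} =
      (\<Sum>k<n. if k = i then v - 1 else v - 2)"
    using j assms by (simp add: card_SigmaI card_Gamma_neighbours_column del: Gamma_adj.simps)
  also have "\<dots> = (v - 1) + (\<Sum>k\<in>{..<n} - {i}. v - 2)"
    using i by (subst sum.remove[of _ i]) auto
  finally show ?thesis using i by simp
qed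

lemma simple_graph_Gamma: "simple_graph (Gamma_verts n v) (Gamma_edges n v)"
proof -
  have "{x, y} \<in> [Gamma_verts n v]\<^bsup>2\<^esup>"
    if "x \<in> Gamma_verts n v" "y \<in> Gamma_verts n v" "Gamma_adj v x y" for x y
  proof -
    have "x \<noteq> y" using that(3) by (cases x) auto
    then show ?thesis using that by (simp add: nsets_def)
  qed
  then show ?thesis
    by (force simp: simple_graph_def Gamma_edges_def Gamma_verts_Times simp del: Gamma_adj.simps)
qed

section \<open>The cliques of \<Gamma>(n,v) with \<open>v\<close> vertices\<close>

text \<open>Once around the cycle the inequalities close up:
  \<open>f 0 \<le> f (v - 1) \<le> f j \<le> f 0\<close>.\<close>

lemma cyclic_descent_constant:
  fixes f :: "nat \<Rightarrow> 'b::order"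
  assumes "\<And>j. j < v \<Longrightarrow> f (Suc j mod v) \<le> f j" and "j < v"
  shows "f j = f 0"
proof -
  have step: "f (Suc i) \<le> f i" if "Suc i < v" for i
    using assms(1)[of i] that by simp
  have down: "f j \<le> f i" if "i \<le> j" "j < v" for i j
    using that by (induction j rule: dec_induct) (auto intro: order_trans[OF step])
  \<comment> \<open>The wrap-around from the last column back to column 0.\<close>
  have "f 0 \<le> f (v - 1)"
    using assms(1)[of "v - 1"] assms(2) by simp
  also have "\<dots> \<le> f j"
    using down assms(2) by simp
  finally show ?thesis
    using down[of 0 j] assms(2) by (simp add: order_antisym)
qed

lemma v_cliques_Gamma:
  assumes "v \<ge> 2"
  shows "v_cliques (Gamma_verts n v) (Gamma_edges n v) v = (\<lambda>i. {i} \<times> {..<v}) ` {..<n}"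
proof (intro equalityI subsetI)
  fix K assume "K \<in> v_cliques (Gamma_verts n v) (Gamma_edges n v) v"
  then have KV: "K \<subseteq> {..<n} \<times> {..<v}" and finK: "finite K" and cardK: "card K = v"
    and adj: "\<And>x y. x \<in> K \<Longrightarrow> y \<in> K \<Longrightarrow> x \<noteq> y \<Longrightarrow> Gamma_adj v x y"
    by (auto simp: v_cliques_def nsets_def clique_def Gamma_edges_iff Gamma_verts_Times)
  have "inj_on snd K"
  proof (rule inj_onI, rule ccontr)
    fix x y assume xy: "x \<in> K" "y \<in> K" "snd x = snd y" "x \<noteq> y"
    obtain i j k l where "x = (i, j)" "y = (k, l)" by fastforce
    with adj[OF xy(1,2,4)] xy KV assms show False
      by (auto simp: Gamma_adj_iff simp del: Gamma_adj.simps)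
  qed
  \<comment> \<open>The \<open>v\<close> vertices of \<open>K\<close> have \<open>v\<close>
    different columns, so no column is missed.\<close>
  then have "snd ` K = {..<v}"
    using KV cardK by (intro card_subset_eq) (auto simp: card_image)
  then have "\<exists>i. (i, j) \<in> K" if "j < v" for j
    using that by (metis imageE lessThan_iff prod.collapse)
  \<comment> \<open>\<open>r j\<close> is the row in which \<open>K\<close> meets column
    \<open>j\<close>.\<close>
  then obtain r where r: "\<And>j. j < v \<Longrightarrow> (r j, j) \<in> K" by metis
  \<comment> \<open>If the row index increased here, the second vertex would lie in just the column
    that adjacency forbids.\<close>
  have "r (Suc j mod v) \<le> r j" if "j < v" for j
  proof -
    have next_column: "Suc j mod v < v" "Suc j mod v \<noteq> j"
      using that assms by (cases "Suc j = v"; simp)+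
    then have "Gamma_adj v (r j, j) (r (Suc j mod v), Suc j mod v)"
      using adj[OF r[OF that] r[OF next_column(1)]] next_column(2) by (simp del: Gamma_adj.simps)
    then show ?thesis
      using that next_column assms by (auto simp: Gamma_adj_iff simp del: Gamma_adj.simps)
  qed
  then have "r j = r 0" if "j < v" for j
    using that by (rule cyclic_descent_constant)
  then have "(r 0, j) \<in> K" if "j < v" for j
    using r that by metis
  then have "{r 0} \<times> {..<v} \<subseteq> K" by auto
  then have "{r 0} \<times> {..<v} = K"
    using finK cardK by (intro card_subset_eq) (auto simp: card_cartesian_product)
  moreover have "r 0 < n"
    using r[of 0] KV assms by auto
  ultimately show "K \<in> (\<lambda>i. {i} \<times> {..<v}) ` {..<n}" by blast
next
  fix K assume "K \<in> (\<lambda>i. {i} \<times> {..<v}) ` {..<n}"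
  then show "K \<in> v_cliques (Gamma_verts n v) (Gamma_edges n v) v"
    by (auto simp: v_cliques_def nsets_def clique_def Gamma_edges_iff Gamma_verts_Times
        card_cartesian_product)
qed

lemma strongly_clique_partitioned_Gamma:
  assumes "v \<ge> 2"
  shows "strongly_clique_partitioned n v (Gamma_verts n v) (Gamma_edges n v)"
proof -
  let ?V = "Gamma_verts n v" and ?E = "Gamma_edges n v"
  let ?R = "(\<lambda>i. {i} \<times> {..<v}) ` {..<n}"
  have cardR: "card ?R = n"
  proof -
    have "i = k" if "{i} \<times> {..<v} = {k} \<times> {..<v}" for i k
    proof -
      have "(i, 0) \<in> {k} \<times> {..<v}" unfolding that[symmetric] using assms by simp
      then show ?thesis by simp
    qed
    then have "inj_on (\<lambda>i. {i} \<times> {..<v}) {..<n}" by (rule inj_onI)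
    then show ?thesis by (simp add: card_image)
  qed
  have "{} \<notin> ?R"
    using assms by (auto simp: eq_commute[of "{}"] lessThan_empty_iff bot_nat_def)
  then have "partition_on ?V ?R"
    by (auto simp: partition_on_def disjoint_def Gamma_verts_Times)
  then have rows: "clique_decomposition ?V ?E n v ?R"
    using assms cardR by (simp add: clique_decomposition_def v_cliques_Gamma)
  \<comment> \<open>A decomposition consists of \<open>v\<close>-cliques, hence of rows; having
    \<open>n\<close> members, it contains all \<open>n\<close> rows.\<close>
  have unique: "P = ?R" if "clique_decomposition ?V ?E n v P" for P
    using that assms cardR
    by (intro card_subset_eq) (auto simp: clique_decomposition_def v_cliques_Gamma)
  have "\<exists>!P. clique_decomposition ?V ?E n v P"
    using rows unique by (rule ex1I)
  moreover have "card ?V = n * v"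
    by (simp add: Gamma_verts_Times card_cartesian_product)
  ultimately show ?thesis
    unfolding strongly_clique_partitioned_def weakly_clique_partitioned_def
    using unique v_cliques_Gamma[OF assms] simple_graph_Gamma by metis
qed

section \<open>The upper bound on degrees and edges\<close>

text \<open>Otherwise \<open>x\<close> and \<open>v - 1\<close> of its neighbours in
  \<open>L\<close> form a \<open>v\<close>-clique. It must be a member of \<open>P\<close>, yet it
  meets \<open>L\<close> and differs from it.\<close>

lemma card_neighbours_other_part:
  assumes P: "clique_decomposition V E n v P" and only: "v_cliques V E v = P" and "v \<ge> 2"
    and "L \<in> P" and "x \<in> V" and "x \<notin> L"
  shows "card {y\<in>L. {x, y} \<in> E} \<le> v - 2"
proof (rule ccontr)
  assume "\<not> ?thesis"
  then have many: "v - 1 \<le> card {y\<in>L. {x, y} \<in> E}" by simp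
  obtain N where N: "N \<subseteq> {y\<in>L. {x, y} \<in> E}" "card N = v - 1" "finite N"
    using obtain_subset_with_card_n[OF many] by blast
  have L: "L \<subseteq> V" "clique L E"
    using \<open>L \<in> P\<close> only by (auto simp: v_cliques_def nsets_def)
  have "x \<notin> N" using N \<open>x \<notin> L\<close> by blast
  then have "card (insert x N) = v"
    using N \<open>v \<ge> 2\<close> by simp
  moreover have "clique (insert x N) E"
    using N L unfolding clique_def by (auto simp: insert_commute)
  ultimately have "insert x N \<in> P"
    using N L \<open>x \<in> V\<close> by (auto simp: only[symmetric] v_cliques_def nsets_def)
  moreover have "insert x N \<noteq> L" using \<open>x \<notin> L\<close> by blast
  ultimately have "insert x N \<inter> L = {}"
    using P \<open>L \<in> P\<close> by (auto simp: clique_decomposition_def partition_on_def disjoint_def)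
  \<comment> \<open>Contradictory because \<open>N\<close> has \<open>v - 1 \<ge> 1\<close>
    elements.\<close>
  then have "N = {}" using N by blast
  then show False using N \<open>v \<ge> 2\<close> by simp
qed

text \<open>The part \<open>K\<close> through \<open>x\<close> contributes at most
  \<open>v - 1\<close> neighbours, as there are no loops, and each of the \<open>n - 1\<close> other
  parts at most \<open>v - 2\<close>.\<close>

lemma degree_le:
  assumes graph: "simple_graph V E" and P: "clique_decomposition V E n v P"
    and only: "v_cliques V E v = P" and "v \<ge> 2" and "x \<in> V"
  shows "card {y\<in>V. {x, y} \<in> E} \<le> (v - 1) + (n - 1) * (v - 2)"
proof -
  have part: "partition_on V P" and cardP: "card P = n"
    using P by (auto simp: clique_decomposition_def)
  have finV: "finite V" and E: "\<And>y. {x, y} \<in> E \<Longrightarrow> x \<noteq> y"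
    using graph by (auto simp: simple_graph_def nsets_def)
  have finP: "finite P" using finV part finite_elements by blast
  obtain K where K: "K \<in> P" "x \<in> K"
    using part \<open>x \<in> V\<close> by (auto simp: partition_on_def)
  have finK: "finite K" and cardK: "card K = v"
    using K only by (auto simp: v_cliques_def nsets_def)
  have own: "card {y\<in>K. {x, y} \<in> E} \<le> v - 1"
  proof -
    have "card {y\<in>K. {x, y} \<in> E} \<le> card (K - {x})"
      using finK E by (intro card_mono) auto
    then show ?thesis using K finK cardK by simp
  qed
  have other: "card {y\<in>L. {x, y} \<in> E} \<le> v - 2" if "L \<in> P - {K}" for L
  proof -
    have "x \<notin> L" using that K part by (auto simp: partition_on_def disjoint_def)
    then show ?thesis
      using card_neighbours_other_part[OF P only] that \<open>v \<ge> 2\<close> \<open>x \<in> V\<close> by blast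
  qed
  have "{y\<in>V. {x, y} \<in> E} = (\<Union>L\<in>P. {y\<in>L. {x, y} \<in> E})"
    using part by (auto simp: partition_on_def)
  then have "card {y\<in>V. {x, y} \<in> E} \<le> (\<Sum>L\<in>P. card {y\<in>L. {x, y} \<in> E})"
    by (simp only: card_UN_le[OF finP])
  also have "\<dots> = card {y\<in>K. {x, y} \<in> E} + (\<Sum>L\<in>P - {K}. card {y\<in>L. {x, y} \<in> E})"
    using finP K by (simp add: sum.remove)
  also have "\<dots> \<le> (v - 1) + (\<Sum>L\<in>P - {K}. v - 2)"
    using own other by (intro add_mono sum_mono) auto
  also have "\<dots> = (v - 1) + (n - 1) * (v - 2)"
    using K finP cardP by simp
  finally show ?thesis .
qed

text \<open>The degree bound summed over all vertices, left doubled to avoid division of natural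
  numbers.\<close>

lemma strongly_clique_partitioned_edges_le:
  assumes "strongly_clique_partitioned n v V E" and "v \<ge> 2"
  shows "2 * card E \<le> n * v * ((v - 1) + (n - 1) * (v - 2))"
proof -
  obtain P where graph: "simple_graph V E" and cardV: "card V = n * v"
    and P: "clique_decomposition V E n v P" and only: "v_cliques V E v = P"
    using assms unfolding strongly_clique_partitioned_def weakly_clique_partitioned_def by blast
  have "2 * card E = (\<Sum>x\<in>V. card {y\<in>V. {x, y} \<in> E})"
    using handshake[OF graph] by simp
  also have "\<dots> \<le> (\<Sum>x\<in>V. (v - 1) + (n - 1) * (v - 2))"
    using degree_le[OF graph P only \<open>v \<ge> 2\<close>] by (intro sum_mono)
  finally show ?thesis by (simp add: cardV)
qed

section \<open>The edge count of \<Gamma>(n,v) and the sharpness of the bound\<close>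

lemma card_Gamma_edges:
  assumes "v \<ge> 2"
  shows "2 * card (Gamma_edges n v) = n * v * ((v - 1) + (n - 1) * (v - 2))"
proof -
  have "2 * card (Gamma_edges n v) = (\<Sum>x\<in>Gamma_verts n v. (v - 1) + (n - 1) * (v - 2))"
    using handshake[OF simple_graph_Gamma, of n v] Gamma_degree assms by simp
  then show ?thesis by (simp add: Gamma_verts_Times card_cartesian_product)
qed

theorem theorem2p3:
  fixes n v :: nat
  assumes "n \<ge> 2" and "v \<ge> 2"
  shows "strongly_clique_partitioned n v (Gamma_verts n v) (Gamma_edges n v) \<and>
    real (card (Gamma_edges n v)) =
      real n / 2 * real v * (real v - 1) + real n * real v * (real n - 1) * (real v - 2) / 2 \<and>
    (\<forall>(V :: 'a set) E. strongly_clique_partitioned n v V E \<longrightarrow>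
      real (card E) \<le>
        real n / 2 * real v * (real v - 1) + real n * real v * (real n - 1) * (real v - 2) / 2)"
proof -
  let ?b = "real n / 2 * real v * (real v - 1) + real n * real v * (real n - 1) * (real v - 2) / 2"
  \<comment> \<open>As \<open>n\<close> and \<open>v\<close> are at least 2, no subtraction of
    natural numbers truncates, and the degree sum becomes twice the real expression
    \<open>?b\<close>.\<close>
  have bound: "real (n * v * ((v - 1) + (n - 1) * (v - 2))) = 2 * ?b"
  proof -
    have "real (n - 1) = real n - 1" "real (v - 1) = real v - 1" "real (v - 2) = real v - 2"
      using assms by (simp_all add: of_nat_diff)
    then show ?thesis by (simp add: field_simps)
  qed
  have "real (2 * card (Gamma_edges n v)) = 2 * ?b"
    unfolding card_Gamma_edges[OF \<open>v \<ge> 2\<close>] by (rule bound)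
  moreover have "real (card E) \<le> ?b" if "strongly_clique_partitioned n v V E"
    for V :: "'a set" and E
  proof -
    have "real (2 * card E) \<le> 2 * ?b"
      unfolding bound[symmetric] of_nat_le_iff
      by (rule strongly_clique_partitioned_edges_le[OF that \<open>v \<ge> 2\<close>])
    then show ?thesis by simp
  qed
  ultimately show ?thesis
    using strongly_clique_partitioned_Gamma[OF \<open>v \<ge> 2\<close>] by simp
qed

end
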